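(* Consider the synchronous singing protocol on a dynamic network, and let ${\cal E}_i$ denote the set of active edges in round $i$. Consider any arbitrary state of the protocol in round $i$. Then $$\mathbb{E}\big[|{\cal E}_{i+3}|\big] \le \tfrac{3}{4}\,|{\cal E}_i| + |A_{i+3}\cup A_{i+2}\cup A_{i+1}|,$$ where the expectation is over the random $\ell$-values chosen in rounds $i$ and later.
   Context: Agents are the vertices of an undirected communication graph; agents know nothing about the graph. Each agent is in one of three states $\{\textsc{Out},\textsc{In},\textsc{Un}\}$ and operates in synchronous rounds (all rounds start and end simultaneously; every note sung in a round is heard by all neighbors by the end of the round). An agent hears the union of notes sung by its neighbors (it detects presence of a note, not multiplicity). Singing protocol (one round, agent in state $s$): compute a fresh $\ell$-value by flipping a fair coin until the first $0$, $\ell$ = number of flips (independent across agents and rounds). If $s=\textsc{Out}$ sing nothing; if $s=\textsc{In}$ sing note $0$; if $s=\textsc{Un}$ sing notes $1,\dots,\ell$. All agents listen for note $0$; $\textsc{Un}$ agents also listen for note $\ell$. End of round: $\textsc{In}$ becomes $\textsc{Un}$ if it heard $0$, else stays $\textsc{In}$; $\textsc{Un}$ becomes $\textsc{Out}$ if it heard $0$, otherwise stays $\textsc{Un}$ if it heard note $\ell$ and becomes $\textsc{In}$ if not; $\textsc{Out}$ stays $\textsc{Out}$ if it heard $0$, else becomes $\textsc{Un}$. Dynamic networks: agents and edges may be inserted or deleted; all such changes are regarded as occurring at the beginning of a round; new agents start in arbitrary states. An agent that changes state arbitrarily or does not execute the protocol correctly at the end of round $i-1$ is modeled as being deleted and reinserted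 (with its edges) in its new state at the beginning of round $i$. An agent is changed in round $i$ if it is incident to an edge added or deleted at the beginning of round $i$. An edge is affected in round $i$ if one of its endpoints is at distance at most $2$ from an agent changed in round $i$; $A_i$ is the set of edges affected in round $i$. An agent is $\textsc{In}^{\overline{\textsc{In}}}$ in a round if it is $\textsc{In}$ and has no $\textsc{In}$ neighbor in that round. An agent is eliminated in round $i$ if it is $\textsc{In}^{\overline{\textsc{In}}}$ or adjacent to an $\textsc{In}^{\overline{\textsc{In}}}$ agent in round $i$; otherwise active. An edge is eliminated if some endpoint is eliminated, otherwise active. *)

theory Defs
  imports "HOL-Probability.Product_PMF"
begin

(* Und is the state "Un" (the name Un is reserved for ASCII set union). *)
datatype state = Out | In | Und

text \<open>
  A graph is given by its edge set, a set of two-element sets of agents. An assignment of states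
  and an assignment of \<open>\<ell>\<close>-values are total functions; only their values on the agents that are
  present matter.
\<close>

definition nbrs :: "'a set set \<Rightarrow> 'a \<Rightarrow> 'a set" where
  "nbrs E v = {u. {u, v} \<in> E}"


subsection \<open>The singing protocol\<close>

text \<open>Number of flips of a fair coin up to and including the first 0
  (\<open>geometric_pmf\<close> does not count the final flip).\<close>

definition ell_pmf :: "nat pmf" where
  "ell_pmf = map_pmf Suc (geometric_pmf (1 / 2))"

fun sung :: "state \<Rightarrow> nat \<Rightarrow> nat set" where
  "sung Out l = {}"
| "sung In l = {0}"
| "sung Und l = {1..l}"

definition heard :: "'a set set \<Rightarrow> ('a \<Rightarrow> state) \<Rightarrow> ('a \<Rightarrow> nat) \<Rightarrow> 'a \<Rightarrow> nat set" where
  "heard E s l v = (\<Union>u\<in>nbrs E v. sung (s u) (l u))"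

definition sing_round :: "'a set set \<Rightarrow> ('a \<Rightarrow> state) \<Rightarrow> ('a \<Rightarrow> nat) \<Rightarrow> 'a \<Rightarrow> state" where
  "sing_round E s l v =
     (case s v of
        In \<Rightarrow> if 0 \<in> heard E s l v then Und else In
      | Und \<Rightarrow> if 0 \<in> heard E s l v then Out
              else if l v \<in> heard E s l v then Und else In
      | Out \<Rightarrow> if 0 \<in> heard E s l v then Out else Und)"


subsection \<open>Eliminated agents and active edges\<close>

definition In_no_In :: "'a set set \<Rightarrow> ('a \<Rightarrow> state) \<Rightarrow> 'a \<Rightarrow> bool" where
  "In_no_In E s v \<longleftrightarrow> s v = In \<and> (\<forall>u\<in>nbrs E v. s u \<noteq> In)"

definition eliminated :: "'a set set \<Rightarrow> ('a \<Rightarrow> state) \<Rightarrow> 'a \<Rightarrow> bool" where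
  "eliminated E s v \<longleftrightarrow> In_no_In E s v \<or> (\<exists>u\<in>nbrs E v. In_no_In E s u)"

definition active_edges :: "'a set set \<Rightarrow> ('a \<Rightarrow> state) \<Rightarrow> 'a set set" where
  "active_edges E s = {e \<in> E. \<forall>v\<in>e. \<not> eliminated E s v}"


subsection \<open>Dynamic networks\<close>

text \<open>
  \<open>agents N j\<close> and \<open>edges N j\<close> describe the network during round \<open>j\<close>, that is, after the changes at
  the beginning of round \<open>j\<close>. The agents inserted at the beginning of round \<open>j\<close> are \<open>inserted N j\<close>;
  they start round \<open>j\<close> in the states \<open>init N j\<close>. An inserted agent that was already present in
  round \<open>j - 1\<close> has been deleted and reinserted, so all its old edges count as deleted and all its
  new edges as added, even those that are in both edge sets.
\<close>

record 'a network =
  agents :: "nat \<Rightarrow> 'a set"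
  edges :: "nat \<Rightarrow> 'a set set"
  inserted :: "nat \<Rightarrow> 'a set"
  init :: "nat \<Rightarrow> 'a \<Rightarrow> state"

definition dynamic_network :: "'a network \<Rightarrow> bool" where
  "dynamic_network N \<longleftrightarrow>
     (\<forall>j. finite (agents N j)
        \<and> (\<forall>e\<in>edges N j. e \<subseteq> agents N j \<and> card e = 2)
        \<and> inserted N j \<subseteq> agents N j
        \<and> agents N (Suc j) - agents N j \<subseteq> inserted N (Suc j))"

text \<open>Changes at the beginning of round \<open>j\<close> are relative to round \<open>j - 1\<close>, so \<open>j \<ge> 1\<close> is intended below.\<close>

definition kept_edges :: "'a network \<Rightarrow> nat \<Rightarrow> 'a set set" where
  "kept_edges N j = {e \<in> edges N (j - 1) \<inter> edges N j. e \<inter> inserted N j = {}}"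

definition deleted_edges :: "'a network \<Rightarrow> nat \<Rightarrow> 'a set set" where
  "deleted_edges N j = edges N (j - 1) - kept_edges N j"

definition added_edges :: "'a network \<Rightarrow> nat \<Rightarrow> 'a set set" where
  "added_edges N j = edges N j - kept_edges N j"

definition changed :: "'a network \<Rightarrow> nat \<Rightarrow> 'a set" where
  "changed N j = \<Union> (deleted_edges N j \<union> added_edges N j)"

text \<open>Distance at most \<open>d\<close>: there is a walk with at most \<open>d\<close> edges.\<close>

definition within_dist :: "'a set set \<Rightarrow> nat \<Rightarrow> 'a \<Rightarrow> 'a \<Rightarrow> bool" where
  "within_dist E d u v \<longleftrightarrow> (\<exists>k\<le>d. (u, v) \<in> {(x, y). {x, y} \<in> E} ^^ k)"

text \<open>Edges of the network of round \<open>j\<close> only; distances are measured in that network. (Measuring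
  them in round \<open>j - 1\<close> selects the same edges, because the first missing edge on a path already
  has a changed endpoint.)\<close>

definition affected :: "'a network \<Rightarrow> nat \<Rightarrow> 'a set set" where
  "affected N j = {e \<in> edges N j. \<exists>v\<in>e. \<exists>c\<in>changed N j. within_dist (edges N j) 2 v c}"


subsection \<open>The protocol on a dynamic network\<close>

definition begin_round :: "'a network \<Rightarrow> nat \<Rightarrow> ('a \<Rightarrow> state) \<Rightarrow> 'a \<Rightarrow> state" where
  "begin_round N j s v = (if v \<in> inserted N j then init N j v else s v)"

text \<open>From the states in round \<open>j\<close> (after the changes at its beginning) to those in round \<open>j + 1\<close>.
  Non-agents have no neighbours, so the default \<open>\<ell>\<close>-value 0 assigned to them has no influence.\<close>

definition round_pmf :: "'a network \<Rightarrow> nat \<Rightarrow> ('a \<Rightarrow> state) \<Rightarrow> ('a \<Rightarrow> state) pmf" where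
  "round_pmf N j s =
     map_pmf (\<lambda>l. begin_round N (Suc j) (sing_round (edges N j) s l))
       (Pi_pmf (agents N j) 0 (\<lambda>_. ell_pmf))"

text \<open>Distribution of the states in round \<open>i + k\<close> if the states in round \<open>i\<close> are \<open>s\<close>; each round draws
  fresh \<open>\<ell>\<close>-values.\<close>

primrec state_pmf :: "'a network \<Rightarrow> nat \<Rightarrow> ('a \<Rightarrow> state) \<Rightarrow> nat \<Rightarrow> ('a \<Rightarrow> state) pmf" where
  "state_pmf N i s 0 = return_pmf s"
| "state_pmf N i s (Suc k) = bind_pmf (state_pmf N i s k) (round_pmf N (i + k))"

end

theory Submission
  imports Defs
begin

text \<open>
  Let \<open>M\<close> be the set of edges that are active in round \<open>i + 2\<close> and not affected in rounds \<open>i + 1\<close>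
  and \<open>i + 2\<close>. After two undisturbed rounds every endpoint of an edge in \<open>M\<close> is undecided and has
  no \<open>In\<close> neighbour. Moreover, every edge from such an endpoint to an undecided neighbour, whether
  in \<open>M\<close> or not, was already active in round \<open>i\<close>; let \<open>G\<close> be the set of active edges of round \<open>i\<close>.

  In the third round, if \<open>{v, w} \<in> M\<close> and the \<open>\<ell>\<close>-value of \<open>v\<close> is strictly larger than those of the
  other undecided neighbours of \<open>v\<close> and \<open>w\<close>, then \<open>v\<close> joins and all edges at \<open>w\<close> are eliminated.
  With \<open>d\<close> counting undecided neighbours, this has probability at least \<open>1 / (2 * (d v + d w))\<close>.
  Charging every edge of \<open>M\<close> from both of its endpoints, as in the analysis of Luby's algorithm,
  shows that on average at least a quarter of \<open>M\<close> is eliminated, up to an error caused by undecided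
  neighbours not joined by edges of \<open>M\<close>. The edges in \<open>G - M\<close> pay for this error. All
  active edges of round \<open>i + 3\<close> that do not survive in \<open>M\<close> are affected.
\<close>

subsection \<open>Competing geometric variables\<close>

lemma measure_ell_lessThan: "measure_pmf.prob ell_pmf {..<Suc k} = 1 - (1 / 2) ^ k"
proof -
  have "Suc -` {..<Suc k} = {..<k}" by auto
  then have "measure_pmf.prob ell_pmf {..<Suc k} = (\<Sum>n<k. (1 / 2) ^ n * (1 / 2))"
    by (simp add: ell_pmf_def measure_map_pmf measure_measure_pmf_finite)
  also have "\<dots> = 1 - (1 / 2) ^ k"
    by (induction k) (simp_all add: field_simps)
  finally show ?thesis .
qed

lemma measure_ell_singleton: "measure_pmf.prob ell_pmf {Suc k} = (1 / 2) ^ Suc k"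
proof -
  have "Suc -` {Suc k} = {k}" by auto
  then have "measure_pmf.prob ell_pmf {Suc k} = measure_pmf.prob (geometric_pmf (1 / 2)) {k}"
    by (simp add: ell_pmf_def measure_map_pmf del: measure_pmf_single)
  then show ?thesis
    by (simp add: measure_pmf_single)
qed

text \<open>The mean value bound for the power function, with the derivative taken at the right end.
  The induction splits off \<open>y\<close> times the previous difference, leaving
  \<open>(y - x) * x ^ Suc m\<close>.\<close>

lemma power_Suc_diff_le:
  fixes x y :: real
  assumes "0 \<le> x" "x \<le> y"
  shows "y ^ Suc m - x ^ Suc m \<le> (real m + 1) * y ^ m * (y - x)"
proof (induction m)
  case (Suc m)
  have "x ^ Suc m \<le> y ^ Suc m"
    using assms by (intro power_mono)
  then have "(y - x) * x ^ Suc m \<le> (y - x) * y ^ Suc m"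
    using assms by (intro mult_left_mono) auto
  moreover have "y * (y ^ Suc m - x ^ Suc m) \<le> y * ((real m + 1) * y ^ m * (y - x))"
    using assms Suc by (intro mult_left_mono) auto
  ultimately show ?case
    by (simp add: algebra_simps)
qed simp

text \<open>The right-hand side is half the upper Riemann sum of \<open>x ^ m\<close> on \<open>[0, a n]\<close> with nodes \<open>a k\<close>.\<close>

lemma sum_geometric_power_ge:
  defines "a \<equiv> \<lambda>k. 1 - (1 / 2 :: real) ^ k"
  shows "a n ^ Suc m / (2 * (real m + 1)) \<le> (\<Sum>k\<le>n. (1 / 2) ^ Suc k * a k ^ m)"
proof (induction n)
  case 0
  then show ?case by (simp add: a_def)
next
  case (Suc n)
  have "0 \<le> a n" "a n \<le> a (Suc n)"
    by (simp_all add: a_def power_le_one)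
  from power_Suc_diff_le[OF this, of m]
  have "a (Suc n) ^ Suc m - a n ^ Suc m \<le> (real m + 1) * a (Suc n) ^ m * (1 / 2) ^ Suc n"
    by (simp add: a_def)
  then have "(a (Suc n) ^ Suc m - a n ^ Suc m) / (2 * (real m + 1))
      \<le> ((real m + 1) * a (Suc n) ^ m * (1 / 2) ^ Suc n) / (2 * (real m + 1))"
    by (intro divide_right_mono) auto
  also have "\<dots> = (1 / 2) ^ Suc (Suc n) * a (Suc n) ^ m"
    by (simp add: field_simps add_nonneg_eq_0_iff)
  finally have "(a (Suc n) ^ Suc m - a n ^ Suc m) / (2 * (real m + 1))
      \<le> (1 / 2) ^ Suc (Suc n) * a (Suc n) ^ m" .
  with Suc show ?case
    unfolding sum.atMost_Suc diff_divide_distrib by linarith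
qed

text \<open>Split by the value \<open>Suc k\<close> of \<open>l v\<close>: the \<open>m\<close>
  rivals all stay at most \<open>k\<close> with probability \<open>a k ^ m\<close>, and the sum over
  \<open>k\<close> is bounded as a Riemann sum. The factor 2 in the bound allows for ties.\<close>

lemma prob_strict_max_ge:
  assumes A: "finite A" "v \<in> A" and K: "K \<subseteq> A - {v}"
  shows "1 / (2 * (real (card K) + 1))
    \<le> measure_pmf.prob (Pi_pmf A d (\<lambda>_. ell_pmf)) {l. \<forall>u\<in>K. l u < l v}"
proof -
  let ?P = "measure_pmf.prob (Pi_pmf A d (\<lambda>_. ell_pmf))"
  let ?win = "{l. \<forall>u\<in>K. l u < l v}"
  define m where "m = card K"
  define a :: "nat \<Rightarrow> real" where "a = (\<lambda>k. 1 - (1 / 2) ^ k)"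
  \<comment> \<open>A box whose coordinates are independent: \<open>l v\<close> is pinned to
    \<open>Suc k\<close>, rivals lie below it, all others are free. Boxes for different
    \<open>k\<close> are disjoint since \<open>l v\<close> determines \<open>k\<close>.\<close>
  define B where "B k x = (if x = v then {Suc k} else if x \<in> K then {..<Suc k} else UNIV)" for k x
  have finK: "finite K" and vK: "v \<notin> K" using A K finite_subset by auto
  have P_B: "?P (Pi A (B k)) = (1 / 2) ^ Suc k * a k ^ m" for k
  proof -
    have "?P (Pi A (B k)) = (\<Prod>x\<in>A. measure_pmf.prob ell_pmf (B k x))"
      using A by (simp add: measure_Pi_pmf_Pi)
    also have "\<dots> = (\<Prod>x\<in>insert v K. measure_pmf.prob ell_pmf (B k x))"
      using A K by (intro prod.mono_neutral_right) (auto simp: B_def)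
    also have "\<dots> = (1 / 2) ^ Suc k * (\<Prod>x\<in>K. measure_pmf.prob ell_pmf (B k x))"
      using finK vK by (simp add: B_def measure_ell_singleton)
    also have "(\<Prod>x\<in>K. measure_pmf.prob ell_pmf (B k x)) = (\<Prod>x\<in>K. a k)"
      using vK by (intro prod.cong) (auto simp: B_def measure_ell_lessThan a_def)
    finally show ?thesis by (simp add: m_def)
  qed
  have "a n ^ Suc m / (2 * (real m + 1)) \<le> ?P ?win" for n
  proof -
    have "a n ^ Suc m / (2 * (real m + 1)) \<le> (\<Sum>k\<le>n. ?P (Pi A (B k)))"
      unfolding P_B a_def by (rule sum_geometric_power_ge)
    also have "\<dots> = ?P (\<Union>k\<le>n. Pi A (B k))"
    proof (rule measure_pmf.finite_measure_finite_Union[symmetric])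
      have "l v = Suc k" if "l \<in> Pi A (B k)" for l k
        using that A by (auto simp: Pi_def B_def split: if_splits)
      then show "disjoint_family_on (\<lambda>k. Pi A (B k)) {..n}"
        unfolding disjoint_family_on_def by (metis disjoint_iff nat.inject)
    qed auto
    also have "\<dots> \<le> ?P ?win"
    proof (rule measure_pmf.finite_measure_mono)
      show "(\<Union>k\<le>n. Pi A (B k)) \<subseteq> ?win"
      proof clarify
        fix k l u
        assume l: "l \<in> Pi A (B k)" and u: "u \<in> K"
        have "l v \<in> B k v" "l u \<in> B k u" using l A K u by (auto simp: Pi_def)
        then show "l u < l v" using u vK by (auto simp: B_def split: if_splits)
      qed
    qed auto
    finally show ?thesis .
  qed
  moreover have "(\<lambda>n. a n ^ Suc m / (2 * (real m + 1))) \<longlonglongrightarrow> (1 - 0) ^ Suc m / (2 * (real m + 1))"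
    unfolding a_def by (intro tendsto_intros LIMSEQ_power_zero) auto
  ultimately have "(1 - 0) ^ Suc m / (2 * (real m + 1)) \<le> ?P ?win"
    by (intro LIMSEQ_le_const2) auto
  then show ?thesis by (simp add: m_def)
qed

subsection \<open>Double counting\<close>

lemma mem_nbrs_commute: "u \<in> nbrs E v \<longleftrightarrow> v \<in> nbrs E u"
  by (simp add: nbrs_def insert_commute)

lemma finite_nbrs: "finite V \<Longrightarrow> \<Union>E \<subseteq> V \<Longrightarrow> finite (nbrs E v)"
  by (rule finite_subset[of _ V]) (auto simp: nbrs_def)

text \<open>Handshake lemma: neighbours of \<open>v\<close> correspond to edges at \<open>v\<close>,
  and every edge is counted at its two ends.\<close>

lemma sum_card_nbrs:
  assumes "finite V" "\<Union>E \<subseteq> V" "\<And>e. e \<in> E \<Longrightarrow> card e = 2"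
  shows "(\<Sum>v\<in>V. card (nbrs E v)) = 2 * card E"
proof -
  have "E \<subseteq> Pow V" using assms by auto
  then have finE: "finite E" using assms(1) finite_subset by blast
  have "(\<Sum>v\<in>V. card (nbrs E v)) = (\<Sum>v\<in>V. card {e \<in> E. v \<in> e})"
  proof (intro sum.cong bij_betw_same_card refl)
    fix v
    have no_loop: "{v} \<notin> E" using assms(3)[of "{v}"] by auto
    show "bij_betw (\<lambda>u. {u, v}) (nbrs E v) {e \<in> E. v \<in> e}"
    proof (rule bij_betwI')
      fix u u' assume "u \<in> nbrs E v" "u' \<in> nbrs E v"
      then show "({u, v} = {u', v}) = (u = u')"
        using no_loop by (auto simp: nbrs_def doubleton_eq_iff)
    next
      fix e assume "e \<in> {e \<in> E. v \<in> e}"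
      then show "\<exists>u\<in>nbrs E v. e = {u, v}"
        using assms(3)[of e] by (auto simp: card_2_iff nbrs_def insert_commute)
    qed (auto simp: nbrs_def)
  qed
  also have "\<dots> = (\<Sum>e\<in>E. card {v \<in> V. v \<in> e})"
    using sum_multicount_gen[of V E "\<lambda>v e. v \<in> e" "\<lambda>e. card {v \<in> V. v \<in> e}"] assms(1) finE by simp
  also have "\<dots> = (\<Sum>e\<in>E. 2)"
  proof (intro sum.cong refl)
    fix e assume e: "e \<in> E"
    then have "{v \<in> V. v \<in> e} = e" using assms(2) by auto
    then show "card {v \<in> V. v \<in> e} = 2" using assms(3) e by simp
  qed
  finally show ?thesis by simp
qed

text \<open>Both sides range over the ordered adjacent pairs, and reversing a pair permutes
  them.\<close>

lemma sum_nbrs_swap: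
  fixes f :: "'a \<Rightarrow> 'a \<Rightarrow> 'b :: comm_monoid_add"
  assumes "finite V" "\<Union>E \<subseteq> V"
  shows "(\<Sum>w\<in>V. \<Sum>v\<in>nbrs E w. f v w) = (\<Sum>w\<in>V. \<Sum>v\<in>nbrs E w. f w v)"
proof -
  have nbrs: "nbrs E w = {v \<in> V. v \<in> nbrs E w}" for w
    using assms by (auto simp: nbrs_def)
  show ?thesis
    by (subst (1 2) nbrs, subst sum.swap_restrict[OF assms(1) assms(1)], subst mem_nbrs_commute) (rule refl)
qed

text \<open>Requiring \<open>v\<close> to beat the neighbours of \<open>w\<close> too makes the events for different \<open>v\<close> and
  the same \<open>w\<close> disjoint, so that their probabilities add up.\<close>

definition win :: "('a \<Rightarrow> 'a set) \<Rightarrow> ('a \<Rightarrow> nat) \<Rightarrow> 'a \<Rightarrow> 'a \<Rightarrow> bool" where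
  "win D l v w \<longleftrightarrow> (\<forall>u\<in>D v \<union> D w - {v}. l u < l v)"

text \<open>An upper estimate of the edges of \<open>M\<close> that stay active: having a winner
  next to an endpoint suffices for elimination. \<open>D\<close> will be instantiated with the
  undecided neighbours.\<close>

definition survivors :: "'a set set \<Rightarrow> ('a \<Rightarrow> 'a set) \<Rightarrow> ('a \<Rightarrow> nat) \<Rightarrow> 'a set set" where
  "survivors M D l = {e \<in> M. \<forall>w\<in>e. \<forall>v\<in>nbrs M w. \<not> win D l v w}"

text \<open>If \<open>D v\<close> were always \<open>nbrs M v\<close>, the expected loss would be at
  least a quarter of \<open>M\<close>. The excess degrees \<open>\<delta>\<close> weaken this, but
  they are paid for by edges of \<open>G - M\<close>.\<close>

lemma expected_survivors_le:
  assumes A: "finite A" "\<Union>M \<subseteq> A" "\<And>v. v \<in> \<Union>M \<Longrightarrow> D v \<subseteq> A"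
    and G: "finite G" "\<And>e. e \<in> G \<Longrightarrow> card e = 2" and MG: "M \<subseteq> G"
    and DM: "\<And>v. nbrs M v \<subseteq> D v"
    and DG: "\<And>v. v \<in> \<Union>M \<Longrightarrow> D v \<subseteq> nbrs G v"
  shows "measure_pmf.expectation (Pi_pmf A 0 (\<lambda>_. ell_pmf)) (\<lambda>l. real (card (survivors M D l)))
    \<le> 3 / 4 * real (card G)"
proof -
  let ?p = "Pi_pmf A 0 (\<lambda>_. ell_pmf)"
  let ?E = "measure_pmf.expectation ?p"
  let ?P = "measure_pmf.prob ?p"
  let ?S = "survivors M D"
  define V where "V = \<Union>M"
  define m where "m w = real (card (nbrs M w))" for w
  define d where "d w = real (card (D w))" for w
  define \<delta> where "\<delta> w = d w - m w" for w
  have VA: "V \<subseteq> A" using A(2) by (simp add: V_def)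
  then have finV: "finite V" using A(1) by (rule finite_subset)
  have finM: "finite M" using MG G(1) finite_subset by blast
  have "finite e" if "e \<in> G" for e using G(2)[OF that] by (intro card_ge_0_finite) simp
  then have finG: "finite (\<Union>G)" using G(1) by simp
  have VG: "V \<subseteq> \<Union>G" using MG by (auto simp: V_def)
  have finD: "finite (D v)" "D v \<subseteq> A" if "v \<in> V" for v
    using that A(3)[of v] finite_subset[OF _ A(1)] by (auto simp: V_def)
  have edge: "w \<in> V" "v \<in> V" "v \<in> D w" "w \<in> D v" if "v \<in> nbrs M w" for v w
    using that DM[of v] DM[of w] mem_nbrs_commute[of v M w] by (auto simp: V_def nbrs_def)
  have m_le_d: "m v \<le> d v" if "v \<in> V" for v
    unfolding m_def d_def using finD[OF that] DM by (simp add: card_mono)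
  have d_pos: "0 < d w" if "v \<in> nbrs M w" for v w
    using edge[OF that] finD[of w] by (auto simp: d_def card_gt_0_iff)
  have card2: "card e = 2" if "e \<in> M" for e using that G MG by auto

  \<comment> \<open>A vertex \<open>w\<close> with a winning neighbour loses all its
    \<open>m w\<close> edges. A lost edge may be charged from both ends, hence the division by
    2.\<close>
  have pointwise: "real (card (?S l)) \<le> real (card M)
      - (\<Sum>w\<in>V. \<Sum>v\<in>nbrs M w. m w * indicator {l. win D l v w} l) / 2" for l
  proof -
    have "(\<Sum>v\<in>nbrs M w. m w * indicator {l. win D l v w} l) \<le> card (nbrs (M - ?S l) w)"
      if w: "w \<in> V" for w
    proof (cases "\<exists>v\<in>nbrs M w. win D l v w")
      case True
      then obtain v where v: "v \<in> nbrs M w" "win D l v w" by blast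
      \<comment> \<open>Two winners for the same \<open>w\<close> both lie in \<open>D w\<close>, so
        each would have to beat the other.\<close>
      have "win D l v' w \<longleftrightarrow> v' = v" if "v' \<in> nbrs M w" for v'
      proof (rule iffI, rule ccontr)
        assume "win D l v' w" "v' \<noteq> v"
        with v that edge have "l v' < l v" "l v < l v'" by (auto simp: win_def)
        then show False by simp
      qed (use v in simp)
      then have "(\<Sum>v'\<in>nbrs M w. m w * indicator {l. win D l v' w} l)
          = (\<Sum>v'\<in>nbrs M w. if v' = v then m w else 0)"
        by (intro sum.cong) (auto simp: indicator_def)
      also have "\<dots> = m w"
        using v finite_nbrs[OF A(1,2)] by simp
      also have "nbrs (M - ?S l) w = nbrs M w"
        using v by (auto simp: nbrs_def survivors_def)
      then have "m w = card (nbrs (M - ?S l) w)" by (simp add: m_def)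
      finally show ?thesis by simp
    qed (simp add: indicator_def sum_nonneg)
    then have "(\<Sum>w\<in>V. \<Sum>v\<in>nbrs M w. m w * indicator {l. win D l v w} l)
        \<le> (\<Sum>w\<in>V. real (card (nbrs (M - ?S l) w)))"
      by (intro sum_mono)
    also have "\<dots> = 2 * card (M - ?S l)"
      using sum_card_nbrs[of V "M - ?S l"] finV card2
      by (simp add: V_def Union_mono flip: of_nat_sum)
    also have "\<dots> = 2 * (real (card M) - real (card (?S l)))"
      using finM by (subst card_Diff_subset) (auto simp: survivors_def card_mono finite_subset)
    finally show ?thesis by simp
  qed

  have prob: "1 / (2 * (d v + d w)) \<le> ?P {l. win D l v w}" if "v \<in> nbrs M w" for v w
  proof -
    let ?K = "D v \<union> D w - {v}"
    have fin: "finite (D v)" "finite (D w)" using finD edge[OF that] by auto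
    \<comment> \<open>Since \<open>v\<close> is in \<open>D w\<close>, removing it from the union
      lowers the cardinality by exactly one, matching the \<open>+ 1\<close> in
      \<open>prob_strict_max_ge\<close>.\<close>
    have "card ?K + 1 = card (D v \<union> D w)"
      using fin edge[OF that] card_Suc_Diff1[of "D v \<union> D w" v] by simp
    also have "\<dots> \<le> card (D v) + card (D w)" by (rule card_Un_le)
    finally have "real (card ?K) + 1 \<le> d v + d w" unfolding d_def by linarith
    then have "1 / (2 * (d v + d w)) \<le> 1 / (2 * (real (card ?K) + 1))"
      by (intro divide_left_mono) (auto simp: add_pos_nonneg d_pos)
    also have "\<dots> \<le> ?P {l. win D l v w}"
      unfolding win_def using A(1) VA edge(1,2)[OF that] finD(2)[OF edge(1)[OF that]] finD(2)[OF edge(2)[OF that]]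
      by (intro prob_strict_max_ge) auto
    finally show ?thesis .
  qed

  let ?X = "\<lambda>l. real (card M) - (\<Sum>w\<in>V. \<Sum>v\<in>nbrs M w. m w * indicator {l. win D l v w} l) / 2"
  let ?x = "real (card M) - (\<Sum>w\<in>V. \<Sum>v\<in>nbrs M w. m w * ?P {l. win D l v w}) / 2"
  have const: "has_bochner_integral ?p (\<lambda>_. real (card M)) (real (card M))"
    by (simp add: has_bochner_integral_iff)
  have X: "has_bochner_integral ?p ?X ?x"
    by (intro has_bochner_integral_diff const has_bochner_integral_divide_zero
        has_bochner_integral_sum has_bochner_integral_mult_right
        has_bochner_integral_real_indicator)
      (auto simp: measure_pmf.emeasure_finite less_top[symmetric])
  have "?E (\<lambda>l. real (card (?S l))) \<le> ?E ?X"
  proof (rule integral_mono[OF _ _ pointwise])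
    have "card (?S l) \<le> card M" for l
      using finM by (intro card_mono) (auto simp: survivors_def)
    then show "integrable ?p (\<lambda>l. real (card (?S l)))"
      by (intro measure_pmf.integrable_const_bound[where B = "real (card M)"] AE_pmfI) auto
    show "integrable ?p ?X" using X by (rule integrable.intros)
  qed
  also have "\<dots> = ?x" using X by (rule has_bochner_integral_integral_eq)
  also have "\<dots> \<le> real (card M) - (\<Sum>w\<in>V. \<Sum>v\<in>nbrs M w. m w * (1 / (2 * (d v + d w)))) / 2"
    by (intro diff_left_mono divide_right_mono sum_mono mult_left_mono prob) (auto simp: m_def)
  also have "\<dots> \<le> 3 / 4 * real (card G)"
  proof -
    define T where "T = (\<Sum>w\<in>V. \<Sum>v\<in>nbrs M w. m w * (1 / (2 * (d v + d w))))"
    have sum_M: "(\<Sum>w\<in>V. m w) = 2 * real (card M)"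
      unfolding m_def using sum_card_nbrs[of V M] finV card2
      by (simp add: V_def flip: of_nat_sum)
    \<comment> \<open>Symmetrizing: in \<open>2 * T\<close> each ordered pair contributes
      \<open>(m w + m v) / (2 * (d v + d w))\<close>, which is 1/2 when \<open>m\<close> and
      \<open>d\<close> agree. There are \<open>2 * card M\<close> ordered pairs.\<close>
    have T': "T = (\<Sum>w\<in>V. \<Sum>v\<in>nbrs M w. m v * (1 / (2 * (d w + d v))))"
      unfolding T_def using finV by (intro sum_nbrs_swap) (auto simp: V_def)
    \<comment> \<open>The inner sum has \<open>m w\<close> equal terms, at most \<open>d w\<close>
      of them, so \<open>w\<close> pays at most \<open>\<delta> w\<close> in total.\<close>
    have \<delta>_sum: "(\<Sum>w\<in>V. \<Sum>v\<in>nbrs M w. \<delta> w / d w) \<le> (\<Sum>w\<in>V. \<delta> w)"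
    proof (rule sum_mono)
      fix w assume w: "w \<in> V"
      have "0 \<le> m w" "m w \<le> d w" using m_le_d[OF w] by (simp_all add: m_def)
      then have "m w / d w \<le> 1" "0 \<le> m w / d w" "0 \<le> \<delta> w"
        by (auto simp: divide_le_eq_1 \<delta>_def)
      then have "m w / d w * \<delta> w \<le> \<delta> w" by (intro mult_left_le_one_le)
      then show "(\<Sum>v\<in>nbrs M w. \<delta> w / d w) \<le> \<delta> w" by (simp add: m_def)
    qed
    have "card M - (\<Sum>w\<in>V. \<delta> w) \<le> (\<Sum>w\<in>V. \<Sum>v\<in>nbrs M w. (1 - \<delta> w / d w - \<delta> v / d v) / 2)"
    proof -
      have "(\<Sum>w\<in>V. \<Sum>v\<in>nbrs M w. (1 - \<delta> w / d w - \<delta> v / d v) / 2)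
        = ((\<Sum>w\<in>V. m w) - (\<Sum>w\<in>V. \<Sum>v\<in>nbrs M w. \<delta> w / d w)
            - (\<Sum>w\<in>V. \<Sum>v\<in>nbrs M w. \<delta> v / d v)) / 2"
        by (simp add: sum_subtractf right_diff_distrib m_def flip: sum_divide_distrib)
      also have "(\<Sum>w\<in>V. \<Sum>v\<in>nbrs M w. \<delta> v / d v) = (\<Sum>w\<in>V. \<Sum>v\<in>nbrs M w. \<delta> w / d w)"
        using finV by (intro sum_nbrs_swap) (auto simp: V_def)
      finally show ?thesis using \<delta>_sum sum_M by simp
    qed
    also have "\<dots> \<le> (\<Sum>w\<in>V. \<Sum>v\<in>nbrs M w. m w * (1 / (2 * (d v + d w))) + m v * (1 / (2 * (d w + d v))))"
    proof (intro sum_mono)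
      fix w v assume e: "w \<in> V" "v \<in> nbrs M w"
      have pos: "0 < d w" "0 < d v" and nonneg: "0 \<le> \<delta> w" "0 \<le> \<delta> v"
        using d_pos[OF e(2)] d_pos[of w v] e mem_nbrs_commute[of v M w] m_le_d edge[OF e(2)]
        by (auto simp: \<delta>_def)
      have "\<delta> w / (d v + d w) \<le> \<delta> w / d w" "\<delta> v / (d v + d w) \<le> \<delta> v / d v"
        using pos nonneg by (auto intro!: divide_left_mono)
      then have "1 - \<delta> w / d w - \<delta> v / d v \<le> 1 - \<delta> w / (d v + d w) - \<delta> v / (d v + d w)"
        by simp
      also have "\<dots> = ((d v + d w) - \<delta> w - \<delta> v) / (d v + d w)"
        using pos by (simp add: diff_divide_distrib)
      also have "\<dots> = (m w + m v) / (d v + d w)"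
        by (simp add: \<delta>_def)
      finally show "(1 - \<delta> w / d w - \<delta> v / d v) / 2
          \<le> m w * (1 / (2 * (d v + d w))) + m v * (1 / (2 * (d w + d v)))"
        by (simp add: add.commute add_divide_distrib del: distrib_left_numeral)
    qed
    also have "\<dots> = 2 * T"
      using T' by (simp add: sum.distrib T_def)
    finally have "card M - (\<Sum>w\<in>V. \<delta> w) \<le> 2 * T" .
    \<comment> \<open>\<open>\<delta> w\<close> counts members of \<open>D w\<close> not joined to
      \<open>w\<close> by an edge of \<open>M\<close>. Their edges to \<open>w\<close> lie in
      \<open>G - M\<close>, and each is counted at most twice.\<close>
    moreover have "(\<Sum>w\<in>V. \<delta> w) \<le> 2 * (real (card G) - real (card M))"
    proof -
      have "(\<Sum>w\<in>V. \<delta> w) \<le> (\<Sum>w\<in>V. real (card (nbrs (G - M) w)))"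
      proof (rule sum_mono)
        fix w assume w: "w \<in> V"
        have "\<delta> w = real (card (D w - nbrs M w))"
          unfolding \<delta>_def d_def m_def using finD[OF w] DM[of w]
          by (subst card_Diff_subset) (auto simp: finite_subset card_mono)
        also have "\<dots> \<le> card (nbrs (G - M) w)"
          using DG[of w] w finite_nbrs[OF finG, of "G - M" w]
          by (intro of_nat_mono card_mono) (auto simp: V_def nbrs_def)
        finally show "\<delta> w \<le> card (nbrs (G - M) w)" .
      qed
      also have "\<dots> \<le> (\<Sum>w\<in>\<Union>G. real (card (nbrs (G - M) w)))"
        using VG finG by (intro sum_mono2) auto
      also have "\<dots> = 2 * real (card (G - M))"
        using sum_card_nbrs[of "\<Union>G" "G - M"] finG G by (auto simp: Union_mono simp flip: of_nat_sum)
      also have "\<dots> = 2 * (real (card G) - real (card M))"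
        using finM MG G by (subst card_Diff_subset) (auto simp: card_mono)
      finally show ?thesis .
    qed
    moreover have "real (card M) \<le> real (card G)"
      using MG G by (simp add: card_mono)
    \<comment> \<open>Indeed \<open>x - t / 2\<close> is at most \<open>3 / 4 * x + d / 4\<close>,
      hence at most \<open>3 / 4 * x + (y - x) / 2\<close>.\<close>
    moreover have "x - t / 2 \<le> 3 / 4 * y"
      if "x - d \<le> 2 * t" "d \<le> 2 * (y - x)" "x \<le> y" for d t x y :: real
      using that by simp
    ultimately have "real (card M) - T / 2 \<le> 3 / 4 * real (card G)"
      by blast
    then show ?thesis by (simp add: T_def)
  qed
  finally show ?thesis .
qed

subsection \<open>Propagation of states away from the changes\<close>

text \<open>Being unaffected, stated per agent. Radius 2 also covers neighbours of neighbours, which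
  \<open>edge_to_Und\<close> uses to keep a second-neighbour \<open>In\<close> agent in
  place.\<close>

definition calm :: "'a network \<Rightarrow> nat \<Rightarrow> 'a \<Rightarrow> bool" where
  "calm N j v \<longleftrightarrow> (\<forall>c\<in>changed N j. \<not> within_dist (edges N j) 2 v c)"

lemma not_affected_calm: "e \<in> edges N j \<Longrightarrow> e \<notin> affected N j \<Longrightarrow> v \<in> e \<Longrightarrow> calm N j v"
  by (auto simp: affected_def calm_def)

lemma calm_not_changed: "calm N j v \<Longrightarrow> v \<notin> changed N j"
  by (force simp: calm_def within_dist_def)

lemma calm_not_changed_nbr:
  assumes "calm N j v" "x \<in> nbrs (edges N j) v"
  shows "x \<notin> changed N j"
proof -
  have "within_dist (edges N j) 2 v x"
    unfolding within_dist_def using assms(2)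
    by (intro exI[of _ 1]) (auto simp: nbrs_def insert_commute)
  then show ?thesis using assms(1) by (auto simp: calm_def)
qed

lemma calm_not_changed_nbr2:
  assumes "calm N j v" "x \<in> nbrs (edges N j) v" "y \<in> nbrs (edges N j) x"
  shows "y \<notin> changed N j"
proof -
  have "within_dist (edges N j) 2 v y"
    unfolding within_dist_def using assms(2,3)
    by (intro exI[of _ 2]) (auto simp: nbrs_def insert_commute numeral_2_eq_2 intro!: relpow_Suc_I)
  then show ?thesis using assms(1) by (auto simp: calm_def)
qed

text \<open>No edge at an unchanged agent is added or deleted. A kept edge moreover avoids
  reinserted agents, so it certifies that both of its ends carry their states over.\<close>

lemma kept_at_unchanged:
  assumes "x \<notin> changed N (Suc j)"
  shows "{u, x} \<in> kept_edges N (Suc j) \<longleftrightarrow> u \<in> nbrs (edges N j) x"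
    and "{u, x} \<in> kept_edges N (Suc j) \<longleftrightarrow> u \<in> nbrs (edges N (Suc j)) x"
  using assms by (auto simp: changed_def deleted_edges_def added_edges_def nbrs_def kept_edges_def)

lemma nbrs_eq_at_unchanged:
  "x \<notin> changed N (Suc j) \<Longrightarrow> nbrs (edges N (Suc j)) x = nbrs (edges N j) x"
  using kept_at_unchanged[of x N j] by blast

section \<open>One round with fixed \<open>\<ell>\<close>-values\<close>

lemma zero_heard_iff: "0 \<in> heard E s l v \<longleftrightarrow> (\<exists>u\<in>nbrs E v. s u = In)"
proof -
  have "0 \<in> sung st k \<longleftrightarrow> st = In" for st k by (cases st) auto
  then show ?thesis by (auto simp: heard_def)
qed

lemma heard_of_Und: "u \<in> nbrs E v \<Longrightarrow> s u = Und \<Longrightarrow> 1 \<le> n \<Longrightarrow> n \<le> l u \<Longrightarrow> n \<in> heard E s l v"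
  by (force simp: heard_def)

lemma heard_imp_le:
  assumes "n \<in> heard E s l v" "1 \<le> n"
  shows "\<exists>u\<in>nbrs E v. s u = Und \<and> n \<le> l u"
proof -
  obtain u where "u \<in> nbrs E v" "n \<in> sung (s u) (l u)" using assms(1) by (auto simp: heard_def)
  with assms(2) show ?thesis by (cases "s u") auto
qed

locale protocol_step =
  fixes N :: "'a network" and j :: nat and t t' :: "'a \<Rightarrow> state" and l :: "'a \<Rightarrow> nat"
  assumes dyn: "dynamic_network N"
    and l_pos: "\<And>v. v \<in> agents N j \<Longrightarrow> 1 \<le> l v"
    and t': "t' = begin_round N (Suc j) (sing_round (edges N j) t l)"
begin

abbreviation "E \<equiv> edges N j"
abbreviation "E' \<equiv> edges N (Suc j)"

lemma nbr_agent: "u \<in> nbrs E v \<Longrightarrow> u \<in> agents N j"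
  using dyn by (fastforce simp: dynamic_network_def nbrs_def)

text \<open>The neighbour supplies a kept edge, so neither end is reinserted. An isolated agent
  could be reinserted without counting as changed; hence the nonemptiness premises below.\<close>

lemma state_at_unchanged:
  assumes "x \<notin> changed N (Suc j)" "u \<in> nbrs E x"
  shows "t' x = sing_round E t l x" "t' u = sing_round E t l u"
proof -
  have "{u, x} \<in> kept_edges N (Suc j)" using kept_at_unchanged[of x] assms by blast
  then show "t' x = sing_round E t l x" "t' u = sing_round E t l u"
    by (auto simp: kept_edges_def t' begin_round_def)
qed

text \<open>If two adjacent agents both ended as \<open>In\<close>, both would have been
  \<open>Und\<close> before. Then the one with the smaller or equal \<open>\<ell>\<close>-value
  hears its own note from the other and stays \<open>Und\<close>. Positivity matters because singing
  starts at note 1.\<close>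

lemma In_imp_In_no_In:
  assumes x: "x \<notin> changed N (Suc j)" "nbrs E x \<noteq> {}" and "t' x = In"
  shows "In_no_In E' t' x"
proof -
  have In: "sing_round E t l x = In"
    using state_at_unchanged[of x] assms by auto
  have "t' y \<noteq> In" if y: "y \<in> nbrs E x" for y
  proof
    assume "t' y = In"
    then have y_In: "sing_round E t l y = In"
      using state_at_unchanged(2)[OF x(1) y] by simp
    have yx: "x \<in> nbrs E y" using y mem_nbrs_commute by metis
    have pos: "1 \<le> l x" "1 \<le> l y" using nbr_agent y yx l_pos by blast+
    have no_In: "t x \<noteq> In" "t y \<noteq> In"
      using In y_In y yx by (auto simp: sing_round_def zero_heard_iff split: state.splits if_splits)
    then have "t x = Und" "t y = Und" "l x \<notin> heard E t l x" "l y \<notin> heard E t l y"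
      using In y_In by (auto simp: sing_round_def split: state.splits if_splits)
    then show False
      using heard_of_Und[OF y, of t "l x" l] heard_of_Und[OF yx, of t "l y" l] pos by linarith
  qed
  then show ?thesis
    using assms nbrs_eq_at_unchanged[OF x(1)] by (auto simp: In_no_In_def)
qed

lemma In_no_In_step:
  assumes x: "x \<notin> changed N (Suc j)" "nbrs E x \<noteq> {}" and "In_no_In E t x"
  shows "In_no_In E' t' x"
proof -
  have "sing_round E t l x = In"
    using assms by (auto simp: In_no_In_def sing_round_def zero_heard_iff)
  then show ?thesis
    using In_imp_In_no_In state_at_unchanged x by fastforce
qed

lemma next_to_In:
  assumes x: "x \<notin> changed N (Suc j)" and "t x \<noteq> In" "y \<in> nbrs E x" "t y = In"
  shows "t' x = Out"
  using assms state_at_unchanged(1)[OF x assms(3)]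
  by (cases "t x") (auto simp: sing_round_def zero_heard_iff)

lemma calm_unchanged:
  assumes "calm N (Suc j) w"
  shows "w \<notin> changed N (Suc j)"
    and "x \<in> nbrs E w \<Longrightarrow> x \<notin> changed N (Suc j)"
    and "x \<in> nbrs E w \<Longrightarrow> y \<in> nbrs E x \<Longrightarrow> y \<notin> changed N (Suc j)"
proof -
  show w: "w \<notin> changed N (Suc j)" using assms calm_not_changed by metis
  show x: "x \<notin> changed N (Suc j)" if "x \<in> nbrs E w" for x
    using calm_not_changed_nbr[OF assms] nbrs_eq_at_unchanged[OF w] that by simp
  show "y \<notin> changed N (Suc j)" if "x \<in> nbrs E w" "y \<in> nbrs E x"
    using calm_not_changed_nbr2[OF assms] nbrs_eq_at_unchanged[OF w]
      nbrs_eq_at_unchanged[OF x] that by simp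
qed

text \<open>The isolated \<open>In\<close> agent witnessing elimination is \<open>w\<close> or a
  neighbour. It is unchanged by calmness, hears no \<open>0\<close>, and so remains an isolated
  \<open>In\<close> agent.\<close>

lemma eliminated_step:
  assumes w: "calm N (Suc j) w" "nbrs E w \<noteq> {}" and el: "eliminated E t w"
  shows "eliminated E' t' w"
proof -
  note unch = calm_unchanged[OF w(1)]
  have "nbrs E x \<noteq> {}" if "x \<in> nbrs E w" for x
    using that mem_nbrs_commute[of x E w] by auto
  with el show ?thesis
    using In_no_In_step unch w(2) nbrs_eq_at_unchanged[OF unch(1)]
    unfolding eliminated_def by metis
qed

lemma In_nbr_imp_eliminated:
  assumes w: "calm N (Suc j) w" and x: "x \<in> nbrs E w" and "t' x = In"
  shows "eliminated E' t' w"
proof -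
  note unch = calm_unchanged[OF w]
  have "nbrs E x \<noteq> {}" using x mem_nbrs_commute[of x E w] by auto
  then have "In_no_In E' t' x"
    using In_imp_In_no_In unch(2)[OF x] assms(3) by blast
  then show ?thesis
    using x nbrs_eq_at_unchanged[OF unch(1)] by (auto simp: eliminated_def)
qed

lemma winner_joins:
  assumes x: "x \<notin> changed N (Suc j)" "nbrs E x \<noteq> {}"
    and "t x = Und" "\<And>u. u \<in> nbrs E x \<Longrightarrow> t u \<noteq> In" "\<And>u. u \<in> nbrs E x \<Longrightarrow> t u = Und \<Longrightarrow> l u < l x"
  shows "t' x = In"
proof -
  obtain u where u: "u \<in> nbrs E x" using x by auto
  then have "1 \<le> l x" using l_pos nbr_agent mem_nbrs_commute[of u E x] by blast
  \<comment> \<open>Hearing note \<open>l x\<close> would need an undecided neighbour whose value is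
    at least \<open>l x\<close>.\<close>
  then have "l x \<notin> heard E t l x" using heard_imp_le[of "l x" E t l x] assms(5) by force
  then show ?thesis
    using state_at_unchanged(1)[OF x(1) u] assms by (auto simp: sing_round_def zero_heard_iff)
qed

end

section \<open>Two calm rounds traced back from an active agent\<close>

locale two_steps =
  a: protocol_step N j s t l + b: protocol_step N "Suc j" t t' l'
  for N :: "'a network" and j s t l t' l' +
  fixes w
  assumes calm: "calm N (Suc j) w" "calm N (Suc (Suc j)) w"
    and has_nbr: "nbrs b.E' w \<noteq> {}"
    and active: "\<not> eliminated b.E' t' w"
begin

lemmas unchanged_a = a.calm_unchanged[OF calm(1)]
lemmas unchanged_b = b.calm_unchanged[OF calm(2)]

lemma nbrs_w: "nbrs b.E' w = nbrs a.E w" "nbrs a.E' w = nbrs a.E w"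
  using nbrs_eq_at_unchanged unchanged_a(1) unchanged_b(1) by metis+

lemma nbrs_nbr: "x \<in> nbrs a.E w \<Longrightarrow> nbrs a.E' x = nbrs a.E x"
  using nbrs_eq_at_unchanged unchanged_a(2) by metis

lemma nonempty: "nbrs a.E w \<noteq> {}" "x \<in> nbrs a.E w \<Longrightarrow> nbrs a.E x \<noteq> {}"
  using has_nbr nbrs_w mem_nbrs_commute[of x a.E w] by auto

lemma active_before: "\<not> eliminated a.E' t w"
  using b.eliminated_step[OF calm(2)] nonempty nbrs_w active by metis

lemma active_initially: "\<not> eliminated a.E s w"
  using a.eliminated_step[OF calm(1)] nonempty active_before by metis

lemma no_In_nbr: "x \<in> nbrs a.E w \<Longrightarrow> t' x \<noteq> In"
  using b.In_nbr_imp_eliminated[OF calm(2)] active nbrs_w by metis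

lemma no_In_nbr_before: "x \<in> nbrs a.E w \<Longrightarrow> t x \<noteq> In"
  using a.In_nbr_imp_eliminated[OF calm(1)] active_before by metis

text \<open>An \<open>In\<close> agent would be isolated, hence eliminated. Becoming or staying
  \<open>Out\<close> requires an \<open>In\<close> neighbour one round earlier, which the first calm
  round excludes.\<close>

lemma active_Und: "t' w = Und"
proof -
  obtain u where u: "u \<in> nbrs a.E' w" using nonempty nbrs_w by auto
  have "t' w \<noteq> In"
    using b.In_imp_In_no_In[OF unchanged_b(1)] nonempty nbrs_w active by (auto simp: eliminated_def)
  moreover have "\<forall>x\<in>nbrs a.E' w. t x \<noteq> In"
    using no_In_nbr_before nbrs_w by auto
  ultimately show ?thesis
    using b.state_at_unchanged(1)[OF unchanged_b(1) u]
    by (cases "t w") (auto simp: sing_round_def zero_heard_iff split: if_splits)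
qed

text \<open>An edge to an undecided neighbour is still active at the start even if it is affected
  since then or inactive by now: a neighbour eliminated at the start would stay next to
  an \<open>In\<close> agent for two rounds, hence be \<open>Out\<close>.\<close>

lemma edge_to_Und:
  assumes x: "x \<in> nbrs a.E w" and "t' x = Und"
  shows "{x, w} \<in> active_edges a.E s"
proof -
  have "\<not> eliminated a.E s x"
  proof
    assume "eliminated a.E s x"
    moreover have "\<not> In_no_In a.E s x"
      using active_initially x by (auto simp: eliminated_def)
    ultimately obtain c where c: "c \<in> nbrs a.E x" "In_no_In a.E s c"
      by (auto simp: eliminated_def)
    have xc: "x \<in> nbrs a.E c" using c mem_nbrs_commute by metis
    have "s x \<noteq> In" using xc c by (auto simp: In_no_In_def)
    then have "t x = Out"
      using a.next_to_In[OF unchanged_a(2)[OF x]] c by (auto simp: In_no_In_def)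
    moreover have "In_no_In a.E' t c"
      using a.In_no_In_step[OF unchanged_a(3)[OF x c(1)]] c xc by auto
    moreover have "c \<in> nbrs a.E' x" using nbrs_nbr[OF x] c by simp
    moreover have "x \<notin> changed N (Suc (Suc j))" using unchanged_b(2) nbrs_w x by simp
    ultimately have "t' x = Out"
      using b.next_to_In[of x c] by (simp add: In_no_In_def)
    with assms show False by simp
  qed
  with active_initially x show ?thesis
    by (auto simp: active_edges_def nbrs_def)
qed

end

subsection \<open>Three rounds\<close>

text \<open>Passing to nonnegative integrals lets the bind unfold without integrability conditions;
  boundedness of \<open>f\<close> permits the passage.\<close>

lemma expectation_bind_pmf_le:
  fixes f :: "'b \<Rightarrow> real"
  assumes f: "\<And>x. 0 \<le> f x" "\<And>x. f x \<le> b"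
    and le: "\<And>x. x \<in> set_pmf p \<Longrightarrow> measure_pmf.expectation (q x) f \<le> c"
  shows "measure_pmf.expectation (bind_pmf p q) f \<le> c"
proof -
  have int: "integrable (measure_pmf r) f" for r
    using f by (intro measure_pmf.integrable_const_bound[where B = b] AE_pmfI) auto
  obtain x where "x \<in> set_pmf p" using set_pmf_not_empty by fast
  then have c: "0 \<le> c"
    using le[of x] Bochner_Integration.integral_nonneg[of "measure_pmf (q x)" f] f by fastforce
  have "ennreal (measure_pmf.expectation (bind_pmf p q) f) = (\<integral>\<^sup>+y. ennreal (f y) \<partial>bind_pmf p q)"
    using f by (intro nn_integral_eq_integral[symmetric] int AE_I2) auto
  also have "\<dots> = (\<integral>\<^sup>+x. \<integral>\<^sup>+y. ennreal (f y) \<partial>q x \<partial>p)"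
    by simp
  also have "\<dots> = (\<integral>\<^sup>+x. ennreal (measure_pmf.expectation (q x) f) \<partial>p)"
    using f by (intro nn_integral_cong nn_integral_eq_integral int AE_I2) auto
  also have "\<dots> \<le> (\<integral>\<^sup>+x. ennreal c \<partial>p)"
    using le by (intro nn_integral_mono_AE AE_pmfI ennreal_leI)
  also have "\<dots> = ennreal c"
    by simp
  finally show ?thesis using c by simp
qed

lemma protocol_step_of_ell:
  assumes "dynamic_network N" "l \<in> set_pmf (Pi_pmf (agents N j) 0 (\<lambda>_. ell_pmf))"
  shows "protocol_step N j t (begin_round N (Suc j) (sing_round (edges N j) t l)) l"
proof
  have "finite (agents N j)" using assms(1) by (simp add: dynamic_network_def)
  then show "1 \<le> l v" if "v \<in> agents N j" for v
    using assms(2) that by (auto simp: set_Pi_pmf PiE_dflt_def ell_pmf_def)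
qed (use assms in auto)

lemma protocol_step_of_round:
  assumes "dynamic_network N" "t' \<in> set_pmf (round_pmf N j t)"
  obtains l where "protocol_step N j t t' l"
  using assms protocol_step_of_ell[OF assms(1)] by (auto simp: round_pmf_def)

lemma finite_edges:
  assumes "dynamic_network N"
  shows "finite (edges N j)"
proof -
  have "edges N j \<subseteq> Pow (agents N j)" "finite (agents N j)"
    using assms by (fastforce simp: dynamic_network_def)+
  then show ?thesis using finite_subset by blast
qed

text \<open>The outcomes of the first two rounds are fixed here; only the
  \<open>\<ell>\<close>-values of round \<open>i + 2\<close> are random.\<close>

lemma expected_active_edges_third_round:
  assumes dyn: "dynamic_network N"
    and a: "protocol_step N i s t1 l1" and b: "protocol_step N (Suc i) t1 t2 l2"
  shows "measure_pmf.expectation (round_pmf N (i + 2) t2)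
           (\<lambda>t. real (card (active_edges (edges N (i + 3)) t)))
         \<le> 3 / 4 * real (card (active_edges (edges N i) s))
           + real (card (affected N (i + 3) \<union> affected N (i + 2) \<union> affected N (i + 1)))"
proof -
  let ?E2 = "edges N (Suc (Suc i))" and ?E3 = "edges N (Suc (Suc (Suc i)))"
  let ?p = "Pi_pmf (agents N (Suc (Suc i))) 0 (\<lambda>_. ell_pmf)"
  define B where "B = affected N (i + 3) \<union> affected N (i + 2) \<union> affected N (i + 1)"
  define G where "G = active_edges (edges N i) s"
  define M where "M = active_edges ?E2 t2 - affected N (i + 2) - affected N (i + 1)"
  define D where "D v = {u \<in> nbrs ?E2 v. t2 u = Und}" for v
  define next_state where
    "next_state l = begin_round N (Suc (Suc (Suc i))) (sing_round ?E2 t2 l)" for l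
  interpret a: protocol_step N i s t1 l1 by fact
  interpret b: protocol_step N "Suc i" t1 t2 l2 by fact

  have M: "two_steps N i s t1 l1 t2 l2 w" if "w \<in> \<Union>M" for w
  proof -
    from that obtain e where e: "e \<in> active_edges ?E2 t2" "e \<notin> affected N (Suc (Suc i))"
        "e \<notin> affected N (Suc i)" "w \<in> e"
      by (auto simp: M_def)
    have "card e = 2" and e_E2: "e \<in> ?E2"
      using e(1) dyn by (auto simp: active_edges_def dynamic_network_def)
    then obtain u where u: "e = {u, w}" using e(4) by (auto simp: card_2_iff)
    have calm: "calm N (Suc (Suc i)) w" using not_affected_calm e_E2 e by metis
    have nbr: "u \<in> nbrs ?E2 w" using u e_E2 by (simp add: nbrs_def)
    \<comment> \<open>\<open>affected\<close> contains only edges of its own round, so not being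
      affected yields calmness in round \<open>i + 1\<close> only once \<open>e\<close> is known to
      exist there.\<close>
    then have "e \<in> edges N (Suc i)"
      using nbrs_eq_at_unchanged[OF calm_not_changed[OF calm]] u by (auto simp: nbrs_def)
    then have "calm N (Suc i) w" using not_affected_calm e by metis
    moreover have "\<not> eliminated ?E2 t2 w" using e by (auto simp: active_edges_def)
    ultimately show ?thesis using calm nbr by unfold_locales auto
  qed

  have nbrs_M: "w \<in> \<Union>M" "v \<in> \<Union>M" if "v \<in> nbrs M w" for v w
    using that by (auto simp: nbrs_def)

  have survive: "active_edges ?E3 (next_state l) \<subseteq> B \<union> survivors M D l"
    if l: "l \<in> set_pmf ?p" for l
  proof
    interpret c: protocol_step N "Suc (Suc i)" t2 "next_state l" l
      unfolding next_state_def using dyn l by (rule protocol_step_of_ell)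
    fix e assume e: "e \<in> active_edges ?E3 (next_state l)"
    show "e \<in> B \<union> survivors M D l"
    proof (cases "e \<in> B")
      case False
      have "card e = 2" and e_E3: "e \<in> ?E3"
        using e dyn by (auto simp: active_edges_def dynamic_network_def)
      have not_aff: "e \<notin> affected N (Suc (Suc (Suc i)))"
        "e \<notin> affected N (i + 2)" "e \<notin> affected N (i + 1)"
        using False by (auto simp: B_def numeral_3_eq_3)
      have calm: "calm N (Suc (Suc (Suc i))) w" if "w \<in> e" for w
        using not_affected_calm[OF e_E3 not_aff(1) that] .
      have e_E2: "e \<in> ?E2" and nonempty: "w \<in> e \<Longrightarrow> nbrs ?E2 w \<noteq> {}" for w
      proof -
        obtain u v where uv: "e = {u, v}" using \<open>card e = 2\<close> by (auto simp: card_2_iff)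
        have "nbrs ?E3 v = nbrs ?E2 v"
          using nbrs_eq_at_unchanged[OF calm_not_changed[OF calm[of v]]] uv by simp
        then show "e \<in> ?E2" using e_E3 uv by (auto simp: nbrs_def)
        then show "nbrs ?E2 w \<noteq> {}" if "w \<in> e"
          using that uv by (auto simp: nbrs_def insert_commute)
      qed
      have active3: "\<not> eliminated ?E3 (next_state l) w" if "w \<in> e" for w
        using e that by (auto simp: active_edges_def)
      have "\<not> eliminated ?E2 t2 w" if "w \<in> e" for w
        using c.eliminated_step[OF calm nonempty] active3 that by metis
      then have "e \<in> M" using e_E2 not_aff by (auto simp: M_def active_edges_def)
      moreover have "\<not> win D l v w" if w: "w \<in> e" and v: "v \<in> nbrs M w" for v w
      proof
        assume win: "win D l v w"
        interpret v: two_steps N i s t1 l1 t2 l2 v using M nbrs_M(2)[OF v] by metis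
        have vw: "v \<in> nbrs ?E2 w" using v by (auto simp: nbrs_def M_def active_edges_def)
        \<comment> \<open>Without loops, discarding \<open>v\<close> in \<open>win\<close> loses no
          neighbour of \<open>v\<close>, so \<open>v\<close> beats all its undecided neighbours and
          joins.\<close>
        have "v \<notin> D v" using dyn by (force simp: D_def nbrs_def dynamic_network_def)
        then have "next_state l v = In"
          using c.calm_unchanged(2)[OF calm[OF w] vw] v.has_nbr v.active_Und v.no_In_nbr
            v.nbrs_w win
          by (intro c.winner_joins) (auto simp: win_def D_def)
        then show False
          using c.In_nbr_imp_eliminated[OF calm[OF w] vw] active3[OF w] by simp
      qed
      ultimately show ?thesis by (auto simp: survivors_def)
    qed auto
  qed

  have finB: "finite B"
    using finite_edges[OF dyn] by (auto simp: B_def affected_def)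
  have finE3: "finite ?E3" and finM: "finite M"
    using finite_edges[OF dyn] by (auto simp: M_def active_edges_def)
  have bounded: "integrable ?p (\<lambda>l. real (card (f l)))"
    if "finite F" "\<And>l. f l \<subseteq> F" for f and F :: "'a set set"
    using that
    by (intro measure_pmf.integrable_const_bound[where B = "real (card F)"] AE_pmfI)
      (auto intro!: card_mono)
  have int_S: "integrable ?p (\<lambda>l. real (card (survivors M D l)))"
    using finM by (rule bounded) (auto simp: survivors_def)

  have "measure_pmf.expectation (round_pmf N (i + 2) t2)
           (\<lambda>t. real (card (active_edges (edges N (i + 3)) t)))
      = measure_pmf.expectation ?p (\<lambda>l. real (card (active_edges ?E3 (next_state l))))"
    by (simp add: round_pmf_def next_state_def numeral_3_eq_3)
  also have "\<dots> \<le> measure_pmf.expectation ?p (\<lambda>l. real (card B) + real (card (survivors M D l)))"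
  proof (intro integral_mono_AE AE_pmfI)
    show "integrable ?p (\<lambda>l. real (card (active_edges ?E3 (next_state l))))"
      using finE3 by (rule bounded) (auto simp: active_edges_def)
    show "real (card (active_edges ?E3 (next_state l))) \<le> real (card B) + real (card (survivors M D l))"
      if "l \<in> set_pmf ?p" for l
    proof -
      have "card (active_edges ?E3 (next_state l)) \<le> card (B \<union> survivors M D l)"
        using survive[OF that] finB finM by (intro card_mono) (auto simp: survivors_def)
      also have "\<dots> \<le> card B + card (survivors M D l)" by (rule card_Un_le)
      finally show ?thesis by linarith
    qed
  qed (use int_S in auto)
  also have "\<dots> = real (card B) + measure_pmf.expectation ?p (\<lambda>l. real (card (survivors M D l)))"
    using int_S by simp
  also have "measure_pmf.expectation ?p (\<lambda>l. real (card (survivors M D l))) \<le> 3 / 4 * real (card G)"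
  proof (rule expected_survivors_le)
    \<comment> \<open>\<open>D\<close> lies between the neighbourhoods in \<open>M\<close> and in
      \<open>G\<close>: \<open>edge_to_Und\<close> gives the upper inclusion,
      \<open>active_Und\<close> the lower one.\<close>
    have DG: "D v \<subseteq> nbrs G v" if "v \<in> \<Union>M" for v
    proof
      interpret v: two_steps N i s t1 l1 t2 l2 v using M that by metis
      show "u \<in> nbrs G v" if "u \<in> D v" for u
        using v.edge_to_Und[of u] that unfolding D_def G_def v.nbrs_w(1) by (simp add: nbrs_def)
    qed
    then show "D v \<subseteq> nbrs G v" if "v \<in> \<Union>M" for v using that .
    show MD: "nbrs M v \<subseteq> D v" for v
    proof
      fix u assume u: "u \<in> nbrs M v"
      interpret u: two_steps N i s t1 l1 t2 l2 u using M nbrs_M(2)[OF u] by metis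
      show "u \<in> D v"
        using u u.active_Und by (auto simp: D_def nbrs_def M_def active_edges_def)
    qed
    show "M \<subseteq> G"
    proof
      fix e assume e: "e \<in> M"
      then have "card e = 2" using dyn by (auto simp: M_def active_edges_def dynamic_network_def)
      then obtain u v where uv: "e = {u, v}" by (auto simp: card_2_iff)
      then have "u \<in> nbrs M v" "v \<in> \<Union>M" using e by (auto simp: nbrs_def)
      then show "e \<in> G" using MD DG uv by (fastforce simp: nbrs_def)
    qed
    show "finite G" using finite_edges[OF dyn, of i] by (simp add: G_def active_edges_def)
    show "card e = 2" if "e \<in> G" for e
      using that dyn
      by (auto simp: G_def active_edges_def dynamic_network_def)
    have edge_agents: "e \<subseteq> agents N (Suc (Suc i))" if "e \<in> ?E2" for e
      using that dyn by (auto simp: dynamic_network_def)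
    then show "\<Union>M \<subseteq> agents N (Suc (Suc i))" by (auto simp: M_def active_edges_def)
    show "D v \<subseteq> agents N (Suc (Suc i))" for v
      using edge_agents by (auto simp: D_def nbrs_def)
    show "finite (agents N (Suc (Suc i)))" using dyn by (simp add: dynamic_network_def)
  qed
  finally show ?thesis by (simp add: B_def G_def)
qed

theorem theorem1:
  fixes N :: "'a network" and i :: nat and s :: "'a \<Rightarrow> state"
  assumes "dynamic_network N"
  shows "measure_pmf.expectation (state_pmf N i s 3)
           (\<lambda>t. real (card (active_edges (edges N (i + 3)) t)))
         \<le> 3 / 4 * real (card (active_edges (edges N i) s))
           + real (card (affected N (i + 3) \<union> affected N (i + 2) \<union> affected N (i + 1)))"
proof -
  let ?f = "\<lambda>t. real (card (active_edges (edges N (i + 3)) t))"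
  have "?f t \<le> real (card (edges N (i + 3)))" for t
    using finite_edges[OF assms] by (intro of_nat_mono card_mono) (auto simp: active_edges_def)
  \<comment> \<open>Condition on the state in round \<open>i + 2\<close>: the bound is the same for
    every reachable \<open>t2\<close>, so it survives averaging.\<close>
  moreover have "measure_pmf.expectation (round_pmf N (i + 2) t2) ?f
      \<le> 3 / 4 * real (card (active_edges (edges N i) s))
           + real (card (affected N (i + 3) \<union> affected N (i + 2) \<union> affected N (i + 1)))"
    if "t2 \<in> set_pmf (state_pmf N i s 2)" for t2
  proof -
    from that obtain t1 where "t1 \<in> set_pmf (round_pmf N i s)" "t2 \<in> set_pmf (round_pmf N (Suc i) t1)"
      by (auto simp: numeral_2_eq_2 bind_return_pmf)
    then show ?thesis
      using protocol_step_of_round[OF assms] expected_active_edges_third_round[OF assms] by metis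
  qed
  moreover have "state_pmf N i s 3 = bind_pmf (state_pmf N i s 2) (round_pmf N (i + 2))"
    by (simp add: numeral_3_eq_3 numeral_2_eq_2)
  ultimately show ?thesis
    by (simp only:) (rule expectation_bind_pmf_le, simp_all only: of_nat_0_le_iff)
qed

end
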